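(* The associative calibration $\omega_{\mathrm{assoc}}\in\Lambda^3\mathbb{R}^7$ and the Cayley calibration $\omega_{\mathrm{Cayley}}\in\Lambda^4\mathbb{R}^8$ are not inner Möbius rigid.
   Context: Write $\mathbb{C}^k\cong\mathbb{R}^{2k}$ with $z_j=x_j+iy_j$. On $\mathbb{R}^6=\mathbb{C}^3$ let $\omega_{\mathrm{symp}}=\sum_{j=1}^3dx_j\wedge dy_j$ and $\omega_{\mathrm{SL}}=\mathrm{Re}(dz_1\wedge dz_2\wedge dz_3)$; on $\mathbb{R}^8=\mathbb{C}^4$ let $\widetilde\omega_{\mathrm{symp}}=\sum_{j=1}^4dx_j\wedge dy_j$ and $\widetilde\omega_{\mathrm{SL}}=\mathrm{Re}(dz_1\wedge dz_2\wedge dz_3\wedge dz_4)$. Let $\pi\colon\mathbb{R}^7=\mathbb{R}\times\mathbb{R}^6\to\mathbb{R}^6$ be the projection $(t,x)\mapsto x$. Then $\omega_{\mathrm{assoc}}=dt\wedge\pi^*\omega_{\mathrm{symp}}+\pi^*\omega_{\mathrm{SL}}\in\Lambda^3\mathbb{R}^7$ and $\omega_{\mathrm{Cayley}}=\frac12\,\widetilde\omega_{\mathrm{symp}}\wedge\widetilde\omega_{\mathrm{symp}}+\widetilde\omega_{\mathrm{SL}}\in\Lambda^4\mathbb{R}^8$; both are calibrations. A covector $\omega\in\Lambda^n\mathbb{R}^m$ (identified with a constant-coefficient form) is a calibration if $\sup\{\omega(v_1,\ldots,v_n): v_i\in\mathbb{R}^m, |v_1|=\cdots=|v_n|=1\}=1$.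 $\mathrm{SO}(\omega)$ is the set of linear isometries $O\colon\mathbb{R}^n\to\mathbb{R}^m$ with $O^*\omega=\mathrm{vol}_{\mathbb{R}^n}$, and $\mathrm{CO}(\omega)=\{\lambda O: O\in\mathrm{SO}(\omega),\lambda\ge0\}$. A map $F\in W^{1,n}_{\mathrm{loc}}(\Omega,\mathbb{R}^m)$, $\Omega\subset\mathbb{R}^n$ open, is a conformal $\omega$-curve if $(DF)_x\in\mathrm{CO}(\omega)$ for a.e. $x\in\Omega$; such maps are identified with their $\mathcal{C}^1$ representatives. $\mathbb{S}^n$ is identified with $\mathbb{R}^n\cup\{\infty\}$. A (nonconstant) Möbius transformation $\mathbb{S}^n\to\mathbb{S}^n$ is an orientation-preserving map given by $x\mapsto y_0+L\big((x-x_0)/|x-x_0|^{\epsilon}\big)$, where $x_0,y_0\in\mathbb{R}^n$, $\epsilon\in\{0,2\}$, $L=\lambda O$ with $\lambda>0$, $O\in\mathrm{O}(n)$, with $\det O=1$ if $\epsilon=0$ and $\det O=-1$ if $\epsilon=2$. A map $F\colon\Omega\to\mathbb{R}^m$ is an inner Möbius curve if $F=A\circ g$, where $A\colon\mathbb{R}^n\to\mathbb{R}^m$, $A(x)=y_0+Lx$ with $y_0\in\mathbb{R}^m$ and $L\colon\mathbb{R}^n\to\mathbb{R}^m$ a linear isometry, and $g\colon\Omega\to\mathbb{R}^n$ is the restriction of a (nonconstant) Möbius transformation $\mathbb{S}^n\to\mathbb{S}^n$. A calibration $\omega\in\Lambda^n\mathbb{R}^m$ is inner Möbius rigid if every nonconstant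 conformal $\omega$-curve defined on a domain in $\mathbb{R}^n$ is an inner Möbius curve. *)

theory Defs
  imports "HOL-Analysis.Analysis" "HOL-Combinatorics.Permutations"
begin

section \<open>Constant-coefficient forms\<close>

text \<open>A \<open>k\<close>-covector on \<open>V\<close> with values in \<open>\<real>\<close> or \<open>\<complex>\<close> is a function of a sequence of vectors
  that looks only at the entries \<open>0, \<dots>, k - 1\<close>.\<close>

type_synonym ('v, 'a) form = "(nat \<Rightarrow> 'v) \<Rightarrow> 'a"

text \<open>The wedge product of a \<open>k\<close>-covector and an \<open>l\<close>-covector, normalized so that
  \<open>(\<alpha> \<and> \<beta>)(u, v) = \<alpha>(u) \<beta>(v) - \<alpha>(v) \<beta>(u)\<close> for 1-covectors.\<close>

definition wedge :: "nat \<Rightarrow> nat \<Rightarrow> ('v, 'a::field_char_0) form \<Rightarrow> ('v, 'a) form \<Rightarrow> ('v, 'a) form" where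
  "wedge k l \<alpha> \<beta> v =
     (\<Sum>\<sigma> | \<sigma> permutes {..<k + l}.
        of_int (sign \<sigma>) * \<alpha> (\<lambda>i. v (\<sigma> i)) * \<beta> (\<lambda>i. v (\<sigma> (k + i)))) / (fact k * fact l)"

definition pullback :: "('u \<Rightarrow> 'v) \<Rightarrow> ('v, 'a) form \<Rightarrow> ('u, 'a) form" where
  "pullback T \<alpha> v = \<alpha> (\<lambda>i. T (v i))"

definition dx :: "'k::finite \<Rightarrow> (complex ^ 'k, real) form" where
  "dx j v = Re (v 0 $ j)"

definition dy :: "'k::finite \<Rightarrow> (complex ^ 'k, real) form" where
  "dy j v = Im (v 0 $ j)"

definition dz :: "'k::finite \<Rightarrow> (complex ^ 'k, complex) form" where
  "dz j v = v 0 $ j"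

definition dt :: "(real \<times> 'v, real) form" where
  "dt v = fst (v 0)"

definition symp_form :: "(complex ^ 'k::finite, real) form" where
  "symp_form v = (\<Sum>j\<in>UNIV. wedge 1 1 (dx j) (dy j) v)"

definition SL_form3 :: "(complex ^ 3, real) form" where
  "SL_form3 v = Re (wedge 1 2 (dz 1) (wedge 1 1 (dz 2) (dz 3)) v)"

definition SL_form4 :: "(complex ^ 4, real) form" where
  "SL_form4 v = Re (wedge 1 3 (dz 1) (wedge 1 2 (dz 2) (wedge 1 1 (dz 3) (dz 4))) v)"

text \<open>An element of \<open>\<Lambda>\<^sup>n V\<close> that is to be compared with the volume form of \<open>real ^ 'n\<close> is a function
  on \<open>'v ^ 'n\<close>. The numeral types count their indices as \<open>1, 2, \<dots>, n\<close> (with \<open>n = 0\<close>), hence the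
  shift by one.\<close>

definition covector_of :: "('v, real) form \<Rightarrow> 'v ^ 'n::{finite, semiring_1} \<Rightarrow> real" where
  "covector_of \<alpha> v = \<alpha> (\<lambda>i. v $ of_nat (Suc i))"

text \<open>The model of \<open>\<real>\<^sup>6\<close>, \<open>\<real>\<^sup>7\<close>, \<open>\<real>\<^sup>8\<close> is \<open>\<complex>\<^sup>3\<close>, \<open>\<real> \<times> \<complex>\<^sup>3\<close>, \<open>\<complex>\<^sup>4\<close>: the library norms on these types
  are the Euclidean ones.\<close>

lemma "DIM(real \<times> (complex ^ 3)) = 7" "DIM(complex ^ 4) = 8"
  by simp_all

definition omega_assoc :: "(real \<times> (complex ^ 3)) ^ 3 \<Rightarrow> real" where
  "omega_assoc =
     covector_of (\<lambda>v. wedge 1 2 dt (pullback snd symp_form) v + pullback snd SL_form3 v)"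

definition omega_Cayley :: "(complex ^ 4) ^ 4 \<Rightarrow> real" where
  "omega_Cayley =
     covector_of (\<lambda>v. 1 / 2 * wedge 2 2 symp_form symp_form v + SL_form4 v)"

section \<open>The sets \<open>SO(\<omega>)\<close> and \<open>CO(\<omega>)\<close>\<close>

definition linear_isometry :: "('u::real_normed_vector \<Rightarrow> 'v::real_normed_vector) \<Rightarrow> bool" where
  "linear_isometry T \<longleftrightarrow> linear T \<and> (\<forall>x. norm (T x) = norm x)"

text \<open>\<open>det v\<close> is the value of the volume form on the rows of \<open>v\<close>.\<close>

definition SO_set :: "('v::euclidean_space ^ 'n \<Rightarrow> real) \<Rightarrow> (real ^ 'n \<Rightarrow> 'v) set" where
  "SO_set \<omega> = {T. linear_isometry T \<and> (\<forall>v :: real ^ 'n ^ 'n. \<omega> (\<chi> i. T (v $ i)) = det v)}"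

definition CO_set :: "('v::euclidean_space ^ 'n \<Rightarrow> real) \<Rightarrow> (real ^ 'n \<Rightarrow> 'v) set" where
  "CO_set \<omega> = {\<lambda>x. c *\<^sub>R T x | c T. c \<ge> 0 \<and> T \<in> SO_set \<omega>}"

section \<open>Local Sobolev spaces\<close>

primrec Ck_on :: "nat \<Rightarrow> 'a::real_normed_vector set \<Rightarrow> ('a \<Rightarrow> 'b::real_normed_vector) \<Rightarrow> bool" where
  "Ck_on 0 S f \<longleftrightarrow> continuous_on S f"
| "Ck_on (Suc k) S f \<longleftrightarrow> (\<forall>x\<in>S. f differentiable (at x)) \<and>
     (\<forall>v. Ck_on k S (\<lambda>x. frechet_derivative f (at x) v))"

definition test_function :: "'a::euclidean_space set \<Rightarrow> ('a \<Rightarrow> real) \<Rightarrow> bool" where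
  "test_function \<Omega> \<phi> \<longleftrightarrow> (\<forall>k. Ck_on k UNIV \<phi>) \<and>
     compact (closure {x. \<phi> x \<noteq> 0}) \<and> closure {x. \<phi> x \<noteq> 0} \<subseteq> \<Omega>"

definition Lp_loc :: "nat \<Rightarrow> 'a::euclidean_space set \<Rightarrow> ('a \<Rightarrow> 'b::real_normed_vector) \<Rightarrow> bool" where
  "Lp_loc p \<Omega> f \<longleftrightarrow> f \<in> borel_measurable (lebesgue_on \<Omega>) \<and>
     (\<forall>K. compact K \<and> K \<subseteq> \<Omega> \<longrightarrow> set_integrable lebesgue K (\<lambda>x. norm (f x) ^ p))"

text \<open>Without local integrability the Bochner integrals below could be 0 by convention.\<close>

definition has_weak_derivative ::
    "'a::euclidean_space set \<Rightarrow> ('a \<Rightarrow> 'v::euclidean_space) \<Rightarrow> ('a \<Rightarrow> 'a \<Rightarrow>\<^sub>L 'v) \<Rightarrow> bool" where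
  "has_weak_derivative \<Omega> F D \<longleftrightarrow> Lp_loc 1 \<Omega> F \<and> Lp_loc 1 \<Omega> D \<and>
     (\<forall>\<phi>. test_function \<Omega> \<phi> \<longrightarrow> (\<forall>e\<in>Basis.
        (LINT x:\<Omega>|lebesgue. frechet_derivative \<phi> (at x) e *\<^sub>R F x) =
        - (LINT x:\<Omega>|lebesgue. \<phi> x *\<^sub>R blinfun_apply (D x) e)))"

definition W1p_loc :: "nat \<Rightarrow> 'a::euclidean_space set \<Rightarrow> ('a \<Rightarrow> 'v::euclidean_space) \<Rightarrow> bool" where
  "W1p_loc p \<Omega> F \<longleftrightarrow> Lp_loc p \<Omega> F \<and> (\<exists>D. has_weak_derivative \<Omega> F D \<and> Lp_loc p \<Omega> D)"

section \<open>Conformal curves and rigidity\<close>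

text \<open>The weak derivative is unique up to null sets, so \<open>\<exists>D\<close> merely names it.\<close>

definition conformal_curve ::
    "('v::euclidean_space ^ 'n \<Rightarrow> real) \<Rightarrow> (real ^ 'n) set \<Rightarrow> (real ^ 'n \<Rightarrow> 'v) \<Rightarrow> bool" where
  "conformal_curve \<omega> \<Omega> F \<longleftrightarrow> open \<Omega> \<and> W1p_loc CARD('n) \<Omega> F \<and>
     (\<exists>D. has_weak_derivative \<Omega> F D \<and> (AE x\<in>\<Omega> in lebesgue. blinfun_apply (D x) \<in> CO_set \<omega>))"

text \<open>The restriction to \<open>\<Omega>\<close> of a Moebius transformation of \<open>\<real>\<^sup>n \<union> {\<infinity>}\<close>, with values in \<open>\<real>\<^sup>n\<close>: for
  \<open>\<epsilon> = 2\<close> the point \<open>x0\<close> is sent to \<open>\<infinity>\<close> and must therefore lie outside \<open>\<Omega>\<close>.\<close>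

definition moebius_on :: "(real ^ 'n) set \<Rightarrow> (real ^ 'n \<Rightarrow> real ^ 'n) \<Rightarrow> bool" where
  "moebius_on \<Omega> g \<longleftrightarrow> (\<exists>x0 y0 (\<epsilon>::nat) c T.
     \<epsilon> \<in> {0, 2} \<and> c > 0 \<and> orthogonal_transformation T \<and>
     det (matrix T) = (if \<epsilon> = 0 then 1 else - 1) \<and>
     (\<epsilon> = 2 \<longrightarrow> x0 \<notin> \<Omega>) \<and>
     (\<forall>x\<in>\<Omega>. g x = y0 + c *\<^sub>R T ((x - x0) /\<^sub>R norm (x - x0) ^ \<epsilon>)))"

definition inner_moebius_curve ::
    "(real ^ 'n) set \<Rightarrow> (real ^ 'n \<Rightarrow> 'v::euclidean_space) \<Rightarrow> bool" where
  "inner_moebius_curve \<Omega> F \<longleftrightarrow> (\<exists>y0 L g. linear_isometry L \<and> moebius_on \<Omega> g \<and>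
     (\<forall>x\<in>\<Omega>. F x = y0 + L (g x)))"

text \<open>Conformal \<open>\<omega>\<close>-curves are identified with their \<open>C\<^sup>1\<close> representatives, so the quantifier ranges
  over the latter. That \<open>\<omega>\<close> is a calibration is not made part of the predicate: otherwise a
  covector could fail to be rigid merely by not being a calibration.\<close>

definition inner_moebius_rigid :: "('v::euclidean_space ^ 'n \<Rightarrow> real) \<Rightarrow> bool" where
  "inner_moebius_rigid \<omega> \<longleftrightarrow> (\<forall>\<Omega> F.
     open \<Omega> \<and> connected \<Omega> \<and> \<Omega> \<noteq> {} \<and> conformal_curve \<omega> \<Omega> F \<and> Ck_on 1 \<Omega> F \<and>
     \<not> F constant_on \<Omega> \<longrightarrow> inner_moebius_curve \<Omega> F)"

end

theory Submission imports Defs begin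

text \<open>The cone over the Clifford torus, consisting of the points \<open>r (exp (i \<theta>\<^sub>1), \<dots>, exp (i \<theta>\<^sub>n))\<close> with
  constant \<open>\<theta>\<^sub>1 + \<dots> + \<theta>\<^sub>n\<close>, is special Lagrangian in \<open>\<complex>\<^sup>n\<close> for a suitable value of the constant
  (Harvey and Lawson), hence calibrated by \<open>omega_assoc\<close> for \<open>n = 3\<close> (inside \<open>{0} \<times> \<complex>\<^sup>3\<close>) and by
  \<open>omega_Cayley\<close> for \<open>n = 4\<close>. Its link is flat, so with \<open>r = exp s\<close> its metric is \<open>exp (2 s)\<close> times a
  flat one. This gives an entire conformal curve that is \<open>2 \<pi>\<close>-periodic in some directions, whereas
  a Moebius transformation that is finite on all of \<open>\<real>\<^sup>n\<close> is an injective similarity.\<close>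

section \<open>Conformal curves that are continuously differentiable\<close>

lemma integrable_lborel_compact_support:
  fixes f :: "'a::euclidean_space \<Rightarrow> 'b::{banach, second_countable_topology}"
  assumes "continuous_on UNIV f" "compact K" "\<And>x. x \<notin> K \<Longrightarrow> f x = 0"
  shows "integrable lborel f"
proof -
  have "integrable lborel (\<lambda>x. indicator K x *\<^sub>R f x)"
    using assms by (intro borel_integrable_compact continuous_on_subset[OF assms(1)]) auto
  also have "(\<lambda>x. indicator K x *\<^sub>R f x) = f"
    using assms(3) by (auto simp: indicator_def fun_eq_iff)
  finally show ?thesis .
qed

lemma lborel_integral_translate:
  fixes f :: "'a::euclidean_space \<Rightarrow> 'b::{banach, second_countable_topology}"
  assumes "f \<in> borel_measurable borel"
  shows "(LINT x|lborel. f (c + x)) = (LINT x|lborel. f x)"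
proof -
  have "(LINT x|lborel. f x) = (LINT x|distr lborel borel ((+) c). f x)"
    by (simp add: lborel_distr_plus)
  also have "\<dots> = (LINT x|lborel. f (c + x))"
    using assms by (intro integral_distr) auto
  finally show ?thesis ..
qed

lemma has_derivative_eq_0_outside:
  assumes der: "(f has_derivative f') (at x)"
    and K: "closed K" "x \<notin> K" "\<And>y. y \<notin> K \<Longrightarrow> f y = 0"
  shows "f' h = 0"
proof -
  have "(f has_derivative (\<lambda>h. 0)) (at x)"
    by (rule has_derivative_transform_within_open[where f = "\<lambda>x. 0" and s = "- K"]) (use K in auto)
  then show ?thesis
    using has_derivative_unique[OF der] by metis
qed

text \<open>The difference quotients of \<open>f\<close> have integral \<open>0\<close> by translation invariance; they converge
  boundedly to the derivative.\<close>

lemma lborel_integral_derivative_eq_0: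
  fixes f :: "'a::euclidean_space \<Rightarrow> 'b::euclidean_space"
  assumes der: "\<And>x. (f has_derivative f' x) (at x)"
    and cont: "continuous_on UNIV (\<lambda>x. f' x e)"
    and K: "compact K" and supp: "\<And>x. x \<notin> K \<Longrightarrow> f x = 0"
  shows "(LINT x|lborel. f' x e) = 0"
proof -
  have contf: "continuous_on UNIV f"
    by (meson der has_derivative_continuous continuous_at_imp_continuous_on)
  have f'0: "f' x e = 0" if "x \<notin> K" for x
    by (rule has_derivative_eq_0_outside[OF der _ that supp]) (use K in \<open>rule compact_imp_closed\<close>)
  obtain M where M: "\<And>x. x \<in> K \<Longrightarrow> norm (f' x e) \<le> M" "M \<ge> 0"
    using compact_imp_bounded[OF compact_continuous_image[OF continuous_on_subset[OF cont] K]]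
    by (auto simp: bounded_pos intro: less_imp_le)
  have M': "norm (f' x e) \<le> M" for x
    using M f'0 by (cases "x \<in> K") auto
  define d where "d n x = real (Suc n) *\<^sub>R (f ((1 / real (Suc n)) *\<^sub>R e + x) - f x)" for n x
  have slope: "((\<lambda>t. f (t *\<^sub>R e + x)) has_derivative (\<lambda>h. h *\<^sub>R f' (t *\<^sub>R e + x) e)) (at t within S)"
    for x t S
  proof -
    have "((\<lambda>t. f (t *\<^sub>R e + x)) has_derivative (\<lambda>h. f' (t *\<^sub>R e + x) (h *\<^sub>R e))) (at t within S)"
      by (rule has_derivative_compose[OF _ der]) (auto intro!: derivative_eq_intros)
    then show ?thesis
      by (simp add: linear_scale[OF has_derivative_linear[OF der]])
  qed
  have d_le: "norm (d n x) \<le> M" for n x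
  proof -
    \<comment> \<open>The mean value inequality along the line \<open>x + t e\<close> bounds all
      quotients by the same \<open>M\<close>.\<close>
    have "onorm (\<lambda>h. h *\<^sub>R f' (t *\<^sub>R e + x) e) \<le> M" for t :: real
      by (rule onorm_le) (simp add: M' mult.commute[of M] mult_left_mono)
    then have "norm (f ((1 / real (Suc n)) *\<^sub>R e + x) - f (0 *\<^sub>R e + x)) \<le> M * norm (1 / real (Suc n) - 0)"
      by (intro differentiable_bound[OF convex_UNIV slope]) auto
    then have "real (Suc n) * norm (f ((1 / real (Suc n)) *\<^sub>R e + x) - f x)
        \<le> real (Suc n) * (M * (1 / real (Suc n)))"
      by (intro mult_left_mono) auto
    then show ?thesis
      by (simp add: d_def del: of_nat_Suc)
  qed
  \<comment> \<open>All steps \<open>1 / (n + 1)\<close> lie in \<open>[0, 1]\<close>, so this one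
    compact set contains the supports of all \<open>d n\<close>; \<open>M\<close> on
    \<open>K'\<close> is then an integrable majorant.\<close>
  define K' where "K' = (\<lambda>(k, t). k - t *\<^sub>R e) ` (K \<times> {0..1})"
  have K': "compact K'"
    unfolding K'_def case_prod_unfold
    by (intro compact_continuous_image continuous_intros compact_Times K) auto
  have d0: "d n x = 0" if "x \<notin> K'" for n x
  proof -
    have "(1 / real (Suc n)) *\<^sub>R e + x \<notin> K"
    proof
      assume "(1 / real (Suc n)) *\<^sub>R e + x \<in> K"
      then have "((1 / real (Suc n)) *\<^sub>R e + x) - (1 / real (Suc n)) *\<^sub>R e \<in> K'"
        unfolding K'_def by (intro image_eqI[where x = "(_, 1 / real (Suc n))"]) auto
      then show False using that by simp
    qed
    moreover have "x \<notin> K"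
    proof
      assume "x \<in> K"
      then have "x - 0 *\<^sub>R e \<in> K'"
        unfolding K'_def by (intro image_eqI[where x = "(_, 0)"]) auto
      then show False using that by simp
    qed
    ultimately show ?thesis by (simp add: d_def supp)
  qed
  have contd: "continuous_on UNIV (d n)" for n
    unfolding d_def
    by (intro continuous_intros continuous_on_compose2[OF contf]) auto
  have "(\<lambda>n. LINT x|lborel. d n x) \<longlonglongrightarrow> (LINT x|lborel. f' x e)"
  proof (rule integral_dominated_convergence[where w = "\<lambda>x. indicator K' x *\<^sub>R M"])
    show "(\<lambda>x. f' x e) \<in> borel_measurable lborel" "\<And>n. d n \<in> borel_measurable lborel"
      using borel_measurable_continuous_onI[OF cont] borel_measurable_continuous_onI[OF contd]
      by simp_all
    show "integrable lborel (\<lambda>x. indicator K' x *\<^sub>R M)"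
      by (intro borel_integrable_compact K' continuous_intros)
    show "AE x in lborel. norm (d n x) \<le> indicator K' x *\<^sub>R M" for n
      using d_le d0 by (intro AE_I2) (auto simp: indicator_def)
    show "AE x in lborel. (\<lambda>n. d n x) \<longlonglongrightarrow> f' x e"
    proof (intro AE_I2)
      fix x
      have "((\<lambda>t. f (t *\<^sub>R e + x)) has_vector_derivative f' (0 *\<^sub>R e + x) e) (at 0)"
        unfolding has_vector_derivative_def by (rule slope)
      then have "((\<lambda>t. norm (f (t *\<^sub>R e + x) - f x - t *\<^sub>R f' x e) / norm t) \<longlongrightarrow> 0) (at 0)"
        by (simp add: has_vector_derivative_def has_derivative_at)
      moreover have "norm (f (t *\<^sub>R e + x) - f x - t *\<^sub>R f' x e) / norm t =
          norm ((f (t *\<^sub>R e + x) - f x) /\<^sub>R t - f' x e)" if "t \<noteq> 0" for t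
      proof -
        have "(f (t *\<^sub>R e + x) - f x) /\<^sub>R t - f' x e = (f (t *\<^sub>R e + x) - f x - t *\<^sub>R f' x e) /\<^sub>R t"
          using that by (simp add: scaleR_diff_right)
        then show ?thesis
          by (simp add: divide_inverse mult.commute)
      qed
      ultimately have "((\<lambda>t. norm ((f (t *\<^sub>R e + x) - f x) /\<^sub>R t - f' x e)) \<longlongrightarrow> 0) (at 0)"
        by (subst (asm) LIM_equal) auto
      then have lim: "((\<lambda>t. (f (t *\<^sub>R e + x) - f x) /\<^sub>R t) \<longlongrightarrow> f' x e) (at 0)"
        by (simp only: tendsto_norm_zero_iff LIM_zero_iff)
      have "filterlim (\<lambda>n. 1 / real (Suc n)) (at 0) sequentially"
        using LIMSEQ_inverse_real_of_nat
        by (auto simp: filterlim_at inverse_eq_divide)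
      from filterlim_compose[OF lim this] show "(\<lambda>n. d n x) \<longlonglongrightarrow> f' x e"
        by (simp add: d_def)
    qed
  qed
  moreover have "(LINT x|lborel. d n x) = 0" for n
  proof -
    have "integrable lborel f"
      by (rule integrable_lborel_compact_support[OF contf K supp])
    moreover have "integrable lborel (\<lambda>x. f ((1 / real (Suc n)) *\<^sub>R e + x))"
      using \<open>integrable lborel f\<close>
      by (intro integrable_distr[of "(+) ((1 / real (Suc n)) *\<^sub>R e)" lborel borel f])
        (simp_all add: lborel_distr_plus)
    ultimately show ?thesis
      using lborel_integral_translate[of f] borel_measurable_continuous_onI[OF contf]
      by (simp add: d_def)
  qed
  ultimately show ?thesis
    by (simp add: LIMSEQ_const_iff)
qed

section \<open>From classical to weak derivatives\<close>

lemma Lp_loc_continuous: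
  fixes f :: "'a::euclidean_space \<Rightarrow> 'b::real_normed_vector"
  assumes "continuous_on UNIV f"
  shows "Lp_loc p UNIV f"
  unfolding Lp_loc_def
proof (intro conjI allI impI)
  show "f \<in> borel_measurable (lebesgue_on UNIV)"
    using borel_measurable_continuous_onI[OF assms]
    by (simp add: lebesgue_on_UNIV_eq measurable_completion)
  fix K :: "'a set"
  assume K: "compact K \<and> K \<subseteq> UNIV"
  have c: "continuous_on UNIV (\<lambda>x. norm (f x) ^ p)"
    by (intro continuous_intros assms)
  have "integrable lborel (\<lambda>x. indicator K x *\<^sub>R norm (f x) ^ p)"
    using K by (intro borel_integrable_compact continuous_on_subset[OF c]) auto
  then show "set_integrable lebesgue K (\<lambda>x. norm (f x) ^ p)"
    unfolding set_integrable_def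
    by (subst integrable_completion) (auto dest: borel_measurable_integrable)
qed

text \<open>Integration by parts: \<open>\<phi> F\<close> has compact support, so the integral of
  its derivative in direction \<open>e\<close> vanishes, and the product rule splits that derivative
  into the two integrands.\<close>

lemma has_weak_derivative_UNIV_C1:
  fixes F :: "'a::euclidean_space \<Rightarrow> 'v::euclidean_space"
  assumes F: "\<And>x. (F has_derivative blinfun_apply (D x)) (at x)"
    and D: "continuous_on UNIV D"
  shows "has_weak_derivative UNIV F D"
  unfolding has_weak_derivative_def
proof (intro conjI allI impI ballI)
  have contF: "continuous_on UNIV F"
    by (meson F has_derivative_continuous continuous_at_imp_continuous_on)
  then show "Lp_loc 1 UNIV F" "Lp_loc 1 UNIV D"
    using D by (simp_all add: Lp_loc_continuous)
  fix \<phi> :: "'a \<Rightarrow> real" and e :: 'a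
  assume "test_function UNIV \<phi>" "e \<in> Basis"
  define \<phi>' where "\<phi>' x = frechet_derivative \<phi> (at x)" for x
  define K where "K = closure {x. \<phi> x \<noteq> 0}"
  have "Ck_on 1 UNIV \<phi>" and K: "compact K"
    using \<open>test_function UNIV \<phi>\<close> unfolding test_function_def K_def by auto
  then have \<phi>: "\<And>x. (\<phi> has_derivative \<phi>' x) (at x)" and cont\<phi>': "continuous_on UNIV (\<lambda>x. \<phi>' x e)"
    by (auto simp: \<phi>'_def frechet_derivative_works)
  have cont\<phi>: "continuous_on UNIV \<phi>"
    by (meson \<phi> has_derivative_continuous continuous_at_imp_continuous_on)
  have \<phi>0: "\<phi> x = 0" if "x \<notin> K" for x
    using that closure_subset[of "{x. \<phi> x \<noteq> 0}"] by (auto simp: K_def)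
  have \<phi>'0: "\<phi>' x e = 0" if "x \<notin> K" for x
    by (rule has_derivative_eq_0_outside[OF \<phi> _ that \<phi>0]) (use K in \<open>rule compact_imp_closed\<close>)
  have cont1: "continuous_on UNIV (\<lambda>x. \<phi>' x e *\<^sub>R F x)"
    and cont2: "continuous_on UNIV (\<lambda>x. \<phi> x *\<^sub>R blinfun_apply (D x) e)"
    by (intro continuous_intros cont\<phi> cont\<phi>' contF D)+
  have "(LINT x|lborel. \<phi> x *\<^sub>R blinfun_apply (D x) e + \<phi>' x e *\<^sub>R F x) = 0"
  proof (rule lborel_integral_derivative_eq_0)
    show "((\<lambda>x. \<phi> x *\<^sub>R F x) has_derivative
        (\<lambda>h. \<phi> x *\<^sub>R blinfun_apply (D x) h + \<phi>' x h *\<^sub>R F x)) (at x)" for x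
      by (rule has_derivative_scaleR[OF \<phi> F])
    show "continuous_on UNIV (\<lambda>x. \<phi> x *\<^sub>R blinfun_apply (D x) e + \<phi>' x e *\<^sub>R F x)"
      by (intro continuous_on_add cont1 cont2)
    show "compact K" "\<And>x. x \<notin> K \<Longrightarrow> \<phi> x *\<^sub>R F x = 0"
      using K \<phi>0 by auto
  qed
  then have "(LINT x|lborel. \<phi>' x e *\<^sub>R F x) = - (LINT x|lborel. \<phi> x *\<^sub>R blinfun_apply (D x) e)"
    using integrable_lborel_compact_support[OF cont1 K] integrable_lborel_compact_support[OF cont2 K]
      \<phi>0 \<phi>'0 by (simp add: add_eq_0_iff)
  then show "(LINT x:UNIV|lebesgue. frechet_derivative \<phi> (at x) e *\<^sub>R F x) =
        - (LINT x:UNIV|lebesgue. \<phi> x *\<^sub>R blinfun_apply (D x) e)"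
    using borel_measurable_continuous_onI[OF cont1] borel_measurable_continuous_onI[OF cont2]
    by (simp add: set_lebesgue_integral_def integral_completion \<phi>'_def)
qed

text \<open>In finite dimension, continuity of \<open>F' x v\<close> in \<open>x\<close> for each
  \<open>v\<close> already gives continuity in the operator norm, so the classical derivative serves
  as the weak one.\<close>

lemma conformal_curve_UNIV_C1:
  fixes F :: "real ^ 'n \<Rightarrow> 'v::euclidean_space"
  assumes F: "\<And>x. (F has_derivative F' x) (at x)"
    and cont: "\<And>v. continuous_on UNIV (\<lambda>x. F' x v)"
    and CO: "\<And>x. F' x \<in> CO_set \<omega>"
  shows "conformal_curve \<omega> UNIV F"
proof -
  define D where "D x = Blinfun (F' x)" for x
  have D: "blinfun_apply (D x) = F' x" for x
    unfolding D_def by (rule bounded_linear_Blinfun_apply[OF has_derivative_bounded_linear[OF F]])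
  have contD: "continuous_on UNIV D"
    by (intro continuous_on_blinfun_componentwise) (simp add: D cont)
  have contF: "continuous_on UNIV F"
    by (meson F has_derivative_continuous continuous_at_imp_continuous_on)
  have "has_weak_derivative UNIV F D"
    using F contD by (intro has_weak_derivative_UNIV_C1) (auto simp: D)
  then show ?thesis
    using CO contF contD unfolding conformal_curve_def W1p_loc_def
    by (auto simp: D intro!: exI[of _ D] Lp_loc_continuous)
qed

section \<open>An obstruction to rigidity\<close>

text \<open>The case \<open>\<epsilon> = 2\<close> would need a pole outside \<open>UNIV\<close>.
  Hence \<open>\<epsilon> = 0\<close>, and \<open>F\<close> is a similarity followed by an isometric
  embedding.\<close>

lemma inj_inner_moebius_curve_UNIV:
  assumes "inner_moebius_curve UNIV F"
  shows "inj F"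
proof -
  obtain y0 L g where L: "linear_isometry L" and g: "moebius_on UNIV g" and F: "\<And>x. F x = y0 + L (g x)"
    using assms by (auto simp: inner_moebius_curve_def)
  obtain x0 z0 c T where c: "c > 0" and T: "orthogonal_transformation T"
    and g: "\<And>x. g x = z0 + c *\<^sub>R T (x - x0)"
    using g by (auto simp: moebius_on_def)
  have "inj L"
    using L by (auto simp: linear_isometry_def linear_injective_0)
      (metis norm_eq_zero)
  moreover have "inj g"
    using c injD[OF orthogonal_transformation_inj[OF T]] by (fastforce simp: g inj_def)
  ultimately show ?thesis
    by (auto simp: F inj_def)
qed

lemma not_inner_moebius_rigidI:
  fixes F :: "real ^ 'n \<Rightarrow> 'v::euclidean_space"
  assumes F: "\<And>x. (F has_derivative F' x) (at x)"
    and cont: "\<And>v. continuous_on UNIV (\<lambda>x. F' x v)"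
    and CO: "\<And>x. F' x \<in> CO_set \<omega>"
    and "F a \<noteq> F b" "\<not> inj F"
  shows "\<not> inner_moebius_rigid \<omega>"
proof -
  have "Ck_on 1 UNIV F"
    using F cont frechet_derivative_at[OF F] by (auto simp: differentiable_def)
  moreover have "\<not> F constant_on UNIV"
    using \<open>F a \<noteq> F b\<close> unfolding constant_on_def by (metis UNIV_I)
  ultimately show ?thesis
    using conformal_curve_UNIV_C1[OF F cont CO] \<open>\<not> inj F\<close> inj_inner_moebius_curve_UNIV[of F]
    unfolding inner_moebius_rigid_def by (metis connected_UNIV open_UNIV UNIV_not_empty)
qed

section \<open>The special Lagrangian forms as determinants\<close>

text \<open>The sum over permutations is unfolded by splitting off one index at a time; the wedge
  formulas below are obtained in the same way.\<close>

lemma det_4: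
  "det (A::'a::comm_ring_1^4^4) =
    A$1$1 * (A$2$2 * A$3$3 * A$4$4 + A$2$3 * A$3$4 * A$4$2 + A$2$4 * A$3$2 * A$4$3
      - A$2$2 * A$3$4 * A$4$3 - A$2$3 * A$3$2 * A$4$4 - A$2$4 * A$3$3 * A$4$2)
  - A$1$2 * (A$2$1 * A$3$3 * A$4$4 + A$2$3 * A$3$4 * A$4$1 + A$2$4 * A$3$1 * A$4$3
      - A$2$1 * A$3$4 * A$4$3 - A$2$3 * A$3$1 * A$4$4 - A$2$4 * A$3$3 * A$4$1)
  + A$1$3 * (A$2$1 * A$3$2 * A$4$4 + A$2$2 * A$3$4 * A$4$1 + A$2$4 * A$3$1 * A$4$2
      - A$2$1 * A$3$4 * A$4$2 - A$2$2 * A$3$1 * A$4$4 - A$2$4 * A$3$2 * A$4$1)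
  - A$1$4 * (A$2$1 * A$3$2 * A$4$3 + A$2$2 * A$3$3 * A$4$1 + A$2$3 * A$3$1 * A$4$2
      - A$2$1 * A$3$3 * A$4$2 - A$2$2 * A$3$1 * A$4$3 - A$2$3 * A$3$2 * A$4$1)"
proof -
  have f1: "finite {2::4, 3, 4}" "1 \<notin> {2::4, 3, 4}" by auto
  have f2: "finite {3::4, 4}" "2 \<notin> {3::4, 4}" by auto
  have f3: "finite {4::4}" "3 \<notin> {4::4}" by auto
  show ?thesis
    unfolding det_def UNIV_4
    unfolding sum_over_permutations_insert[OF f1]
    unfolding sum_over_permutations_insert[OF f2]
    unfolding sum_over_permutations_insert[OF f3]
    unfolding permutes_sing
    by (simp add: sign_swap_id permutation_swap_id permutation_compose sign_compose sign_id
        swap_id_eq algebra_simps)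
qed

lemma wedge_1_1:
  "wedge 1 1 (\<lambda>v. a (v 0)) (\<lambda>v. b (v 0)) v = a (v 0) * b (v 1) - a (v 1) * b (v 0)"
proof -
  have s: "{..<1 + 1::nat} = {0, 1}" by auto
  have f: "finite {1::nat}" "0 \<notin> {1::nat}" by auto
  show ?thesis
    unfolding wedge_def s
    unfolding sum_over_permutations_insert[OF f]
    unfolding permutes_sing
    by (simp add: sign_swap_id sign_id)
qed

text \<open>Here \<open>b\<close> is an arbitrary function of two vectors, so all six permutations
  leave separate terms; for alternating \<open>b\<close> they agree in pairs and cancel the
  denominator \<open>1! 2!\<close>.\<close>

lemma wedge_1_2:
  "wedge 1 2 (\<lambda>v. a (v 0)) (\<lambda>v. b (v 0) (v 1)) v =
    (a (v 0) * (b (v 1) (v 2) - b (v 2) (v 1)) - a (v 1) * (b (v 0) (v 2) - b (v 2) (v 0))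
      + a (v 2) * (b (v 0) (v 1) - b (v 1) (v 0))) / 2"
proof -
  have s: "{..<1 + 2::nat} = {0, 1, 2}" by auto
  have f1: "finite {1::nat, 2}" "0 \<notin> {1::nat, 2}" by auto
  have f2: "finite {2::nat}" "1 \<notin> {2::nat}" by auto
  show ?thesis
    unfolding wedge_def s
    unfolding sum_over_permutations_insert[OF f1]
    unfolding sum_over_permutations_insert[OF f2]
    unfolding permutes_sing
    by (simp add: sign_swap_id permutation_swap_id sign_compose sign_id
        Transposition.transpose_def numeral_2_eq_2 field_simps)
qed

lemma wedge_1_3:
  fixes a :: "'v \<Rightarrow> 'b::field_char_0"
  shows
  "wedge 1 3 (\<lambda>v. a (v 0)) (\<lambda>v. b (v 0) (v 1) (v 2)) v =
    (  a (v 0) * (b (v 1) (v 2) (v 3) + b (v 2) (v 3) (v 1) + b (v 3) (v 1) (v 2)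
                - b (v 1) (v 3) (v 2) - b (v 3) (v 2) (v 1) - b (v 2) (v 1) (v 3))
     - a (v 1) * (b (v 0) (v 2) (v 3) + b (v 2) (v 3) (v 0) + b (v 3) (v 0) (v 2)
                - b (v 0) (v 3) (v 2) - b (v 3) (v 2) (v 0) - b (v 2) (v 0) (v 3))
     + a (v 2) * (b (v 0) (v 1) (v 3) + b (v 1) (v 3) (v 0) + b (v 3) (v 0) (v 1)
                - b (v 0) (v 3) (v 1) - b (v 3) (v 1) (v 0) - b (v 1) (v 0) (v 3))
     - a (v 3) * (b (v 0) (v 1) (v 2) + b (v 1) (v 2) (v 0) + b (v 2) (v 0) (v 1)
                - b (v 0) (v 2) (v 1) - b (v 2) (v 1) (v 0) - b (v 1) (v 0) (v 2))) / 6"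
proof -
  have s: "{..<1 + 3::nat} = {0, 1, 2, 3}" by auto
  have f1: "finite {1::nat, 2, 3}" "0 \<notin> {1::nat, 2, 3}" by auto
  have f2: "finite {2::nat, 3}" "1 \<notin> {2::nat, 3}" by auto
  have f3: "finite {3::nat}" "2 \<notin> {3::nat}" by auto
  have fact3: "(fact 3 :: 'b) = 6" by (simp add: fact_numeral)
  show ?thesis
    unfolding wedge_def s
    unfolding sum_over_permutations_insert[OF f1]
    unfolding sum_over_permutations_insert[OF f2]
    unfolding sum_over_permutations_insert[OF f3]
    unfolding permutes_sing
    by (simp add: sign_swap_id permutation_swap_id permutation_compose sign_compose sign_id
        Transposition.transpose_def fact3
        numeral_2_eq_2 numeral_3_eq_3 field_simps)
qed

lemma wedge_dz_dz: "wedge 1 1 (dz j) (dz k) v = v 0 $ j * v 1 $ k - v 1 $ j * v 0 $ k"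
  unfolding dz_def[abs_def] by (rule wedge_1_1)

lemma symp_form_eq:
  "symp_form v = (\<Sum>j\<in>UNIV. Re (v 0 $ j) * Im (v 1 $ j) - Re (v 1 $ j) * Im (v 0 $ j))"
  unfolding symp_form_def dx_def[abs_def] dy_def[abs_def]
  by (intro sum.cong refl wedge_1_1)

text \<open>This is the Laplace expansion, along the first column, of the determinant with rows
  \<open>v 0\<close>, \<open>v 1\<close>, \<open>v 2\<close> and columns \<open>i\<close>,
  \<open>j\<close>, \<open>k\<close>.\<close>

lemma wedge_dz_dz_dz:
  "wedge 1 2 (dz i) (wedge 1 1 (dz j) (dz k)) v =
     v 0 $ i * (v 1 $ j * v 2 $ k - v 2 $ j * v 1 $ k)
   - v 1 $ i * (v 0 $ j * v 2 $ k - v 2 $ j * v 0 $ k)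
   + v 2 $ i * (v 0 $ j * v 1 $ k - v 1 $ j * v 0 $ k)"
proof -
  have "wedge 1 2 (dz i) (wedge 1 1 (dz j) (dz k)) v =
    wedge 1 2 (\<lambda>v. v 0 $ i) (\<lambda>v. v 0 $ j * v 1 $ k - v 1 $ j * v 0 $ k) v"
    by (subst wedge_dz_dz[abs_def]) (simp only: dz_def[abs_def])
  also have "\<dots> = v 0 $ i * (v 1 $ j * v 2 $ k - v 2 $ j * v 1 $ k)
   - v 1 $ i * (v 0 $ j * v 2 $ k - v 2 $ j * v 0 $ k)
   + v 2 $ i * (v 0 $ j * v 1 $ k - v 1 $ j * v 0 $ k)"
    unfolding wedge_1_2[of "\<lambda>x. x $ i" "\<lambda>x y. x $ j * y $ k - y $ j * x $ k"]
    by (simp add: field_simps)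
  finally show ?thesis .
qed

text \<open>Again a Laplace expansion along the first column, with \<open>b\<close> giving the 3 by
  3 minors.\<close>

lemma wedge_dz_dz_dz_dz:
  "wedge 1 3 (dz h) (wedge 1 2 (dz i) (wedge 1 1 (dz j) (dz k))) v =
    (let b = (\<lambda>x y z. x $ i * (y $ j * z $ k - z $ j * y $ k) - y $ i * (x $ j * z $ k - z $ j * x $ k)
        + z $ i * (x $ j * y $ k - y $ j * x $ k))
     in v 0 $ h * b (v 1) (v 2) (v 3) - v 1 $ h * b (v 0) (v 2) (v 3)
      + v 2 $ h * b (v 0) (v 1) (v 3) - v 3 $ h * b (v 0) (v 1) (v 2))"
proof -
  define b where "b x y z = x $ i * (y $ j * z $ k - z $ j * y $ k) - y $ i * (x $ j * z $ k - z $ j * x $ k)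
        + z $ i * (x $ j * y $ k - y $ j * x $ k)" for x y z :: "complex ^ 'a"
  have "wedge 1 3 (dz h) (wedge 1 2 (dz i) (wedge 1 1 (dz j) (dz k))) v =
    wedge 1 3 (\<lambda>v. v 0 $ h) (\<lambda>v. b (v 0) (v 1) (v 2)) v"
    by (subst wedge_dz_dz_dz[abs_def]) (simp only: dz_def[abs_def] b_def)
  also have "\<dots> = v 0 $ h * b (v 1) (v 2) (v 3) - v 1 $ h * b (v 0) (v 2) (v 3)
      + v 2 $ h * b (v 0) (v 1) (v 3) - v 3 $ h * b (v 0) (v 1) (v 2)"
    unfolding wedge_1_3[of "\<lambda>x. x $ h" b]
    by (simp add: b_def field_simps)
  finally show ?thesis by (simp add: b_def Let_def)
qed

lemma SL_form3_eq_det: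
  "SL_form3 (\<lambda>i. w $ of_nat (Suc i)) = Re (det w)"
proof -
  \<comment> \<open>Positions in a form start at 0, whereas \<open>det_3\<close> names the indices
    1, 2, 3.\<close>
  have "of_nat (Suc 0) = (1::3)" "of_nat (Suc 1) = (2::3)" "of_nat (Suc 2) = (3::3)"
    by simp_all
  then have "wedge 1 2 (dz 1) (wedge 1 1 (dz 2) (dz 3)) (\<lambda>i. w $ of_nat (Suc i)) = det w"
    unfolding wedge_dz_dz_dz det_3 by (simp only: algebra_simps)
  then show ?thesis
    by (simp only: SL_form3_def)
qed

lemma SL_form4_eq_det:
  "SL_form4 (\<lambda>i. w $ of_nat (Suc i)) = Re (det w)"
proof -
  have "of_nat (Suc 0) = (1::4)" "of_nat (Suc 1) = (2::4)" "of_nat (Suc 2) = (3::4)" "of_nat (Suc 3) = (4::4)"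
    by simp_all
  then have "wedge 1 3 (dz 1) (wedge 1 2 (dz 2) (wedge 1 1 (dz 3) (dz 4)))
      (\<lambda>i. w $ of_nat (Suc i)) = det w"
    unfolding wedge_dz_dz_dz_dz Let_def det_4 by (simp only: algebra_simps)
  then show ?thesis
    by (simp only: SL_form4_def)
qed

section \<open>The conformal parametrization of the cone\<close>

definition mean :: "real ^ 'n \<Rightarrow> real" where
  "mean y = (\<Sum>j\<in>UNIV. y $ j) / real CARD('n)"

lemma bounded_linear_mean: "bounded_linear mean"
  unfolding mean_def
  by (intro bounded_linear_divide[THEN bounded_linear_compose] bounded_linear_sum bounded_linear_vec_nth)

lemma sum_eq_mean: "(\<Sum>j\<in>UNIV. y $ j) = real CARD('n) * mean (y :: real ^ 'n)"
  by (simp add: mean_def)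

text \<open>The coordinates are \<open>y = s (1, \<dots>, 1) + \<theta>\<close> with \<open>\<theta>\<close> orthogonal to \<open>(1, \<dots>, 1)\<close>; the metric of the cone is
  \<open>exp (2 s) (n ds\<^sup>2 + d\<theta>\<^sub>1\<^sup>2 + \<dots> + d\<theta>\<^sub>n\<^sup>2) = exp (2 s) |dy|\<^sup>2\<close>. The phases \<open>p\<close> cancel the determinant of
  \<open>cone_matrix\<close> below.\<close>

definition cone_map :: "complex ^ 'n \<Rightarrow> real ^ 'n \<Rightarrow> complex ^ 'n" where
  "cone_map p y = (\<chi> j. p $ j * exp (Complex (mean y) (y $ j - mean y)))"

text \<open>For \<open>q = cone_map p y\<close> this is the differential at \<open>y\<close>. With
  \<open>q\<close> as a separate argument the conformal factor can be pulled out, which leaves a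
  \<open>q\<close> with entries of modulus 1.\<close>

definition cone_diff :: "complex ^ 'n \<Rightarrow> real ^ 'n \<Rightarrow> complex ^ 'n" where
  "cone_diff q h = (\<chi> j. q $ j * Complex (mean h) (h $ j - mean h))"

lemma bounded_linear_Complex_mean: "bounded_linear (\<lambda>y. Complex (mean y) (y $ j - mean y))"
  unfolding Complex_eq
  by (intro bounded_linear_add bounded_linear_const_mult
      bounded_linear_of_real[THEN bounded_linear_compose] bounded_linear_sub
      bounded_linear_mean bounded_linear_vec_nth)

text \<open>The inner product with a basis vector \<open>axis j b\<close> is the inner product of
  the component \<open>j\<close> with \<open>b\<close>.\<close>

lemma has_derivative_vecI:
  fixes f :: "'a::real_normed_vector \<Rightarrow> 'b::euclidean_space ^ 'n"
  assumes "\<And>j. ((\<lambda>x. f x $ j) has_derivative (\<lambda>h. f' h $ j)) (at x within S)"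
  shows "(f has_derivative f') (at x within S)"
  unfolding has_derivative_componentwise_within[of f]
  by (auto simp: Basis_vec_def inner_axis intro!: has_derivative_inner_left assms)

text \<open>Each component is a constant times the exponential of a real-linear map, so its
  derivative is its own value times that map.\<close>

lemma has_derivative_cone_map:
  fixes p :: "complex ^ 'n"
  shows "(cone_map p has_derivative cone_diff (cone_map p y)) (at y)"
proof (rule has_derivative_vecI)
  fix j :: 'n
  let ?l = "\<lambda>y. Complex (mean y) (y $ j - mean y)"
  have "(?l has_derivative ?l) (at y)"
    by (rule bounded_linear_imp_has_derivative[OF bounded_linear_Complex_mean])
  then have "((\<lambda>y. exp (?l y)) has_derivative (\<lambda>h. exp (?l y) * ?l h)) (at y)"
    by (rule has_derivative_compose) (metis DERIV_exp has_field_derivative_def)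
  then have "((\<lambda>y. p $ j * exp (?l y)) has_derivative (\<lambda>h. p $ j * (exp (?l y) * ?l h))) (at y)"
    by (rule has_derivative_mult_right)
  then show "((\<lambda>y. cone_map p y $ j) has_derivative (\<lambda>h. cone_diff (cone_map p y) h $ j)) (at y)"
    by (simp add: cone_map_def cone_diff_def mult.assoc)
qed

lemma continuous_on_cone_diff_cone_map:
  fixes p :: "complex ^ 'n"
  shows "continuous_on UNIV (\<lambda>y. cone_diff (cone_map p y) h)"
proof -
  have "continuous_on UNIV (\<lambda>y :: real ^ 'n. mean y)"
    by (rule linear_continuous_on[OF bounded_linear_mean])
  then show ?thesis
    unfolding cone_map_def cone_diff_def vec_lambda_beta by (intro continuous_intros)
qed

section \<open>The differential is conformal and calibrated\<close>

text \<open>The angles \<open>y $ j - mean y\<close> sum to 0, so moving along the cone changes the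
  phases but not their product. The factor \<open>exp (mean y)\<close> is the radius
  \<open>r\<close> and will be the conformal factor.\<close>

lemma cone_map_eq_scaleR:
  fixes p :: "complex ^ 'n"
  assumes "\<And>j. cmod (p $ j) = 1"
  obtains q where "\<And>j. cmod (q $ j) = 1" "(\<Prod>j\<in>UNIV. q $ j) = (\<Prod>j\<in>UNIV. p $ j)"
    "cone_map p y = exp (mean y) *\<^sub>R q"
proof
  define q :: "complex ^ 'n" where "q = (\<chi> j. p $ j * exp (\<i> * of_real (y $ j - mean y)))"
  show "cmod (q $ j) = 1" for j
    using assms by (simp add: q_def norm_mult)
  have "(\<Sum>j\<in>UNIV. y $ j - mean y) = 0"
    by (simp add: sum_subtractf sum_eq_mean)
  then have "(\<Sum>j\<in>UNIV. \<i> * complex_of_real (y $ j - mean y)) = 0"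
    by (simp only: sum_distrib_left[symmetric] of_real_sum[symmetric]) simp
  then have "(\<Prod>j\<in>UNIV. exp (\<i> * complex_of_real (y $ j - mean y))) = 1"
    by (simp only: exp_sum[symmetric] finite_UNIV finite) simp
  then show "(\<Prod>j\<in>UNIV. q $ j) = (\<Prod>j\<in>UNIV. p $ j)"
    by (simp add: q_def prod.distrib)
  show "cone_map p y = exp (mean y) *\<^sub>R q"
    by (simp add: vec_eq_iff cone_map_def q_def Complex_eq exp_add exp_of_real scaleR_conv_of_real[where 'a = complex])
qed

lemma cone_diff_scaleR: "cone_diff (r *\<^sub>R q) h = r *\<^sub>R cone_diff q h"
  by (simp add: vec_eq_iff cone_diff_def)

text \<open>With \<open>m = mean h\<close>, the component \<open>j\<close> has squared modulus
  \<open>m^2 + (h $ j - m)^2\<close>. This exceeds \<open>(h $ j)^2\<close> by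
  \<open>2 m^2 - 2 m (h $ j)\<close>, which sums to 0 over \<open>j\<close>.\<close>

lemma linear_isometry_cone_diff:
  fixes q :: "complex ^ 'n"
  assumes "\<And>j. cmod (q $ j) = 1"
  shows "linear_isometry (cone_diff q)"
  unfolding linear_isometry_def
proof
  show "linear (cone_diff q)"
    by (rule linearI)
      (simp_all add: cone_diff_def vec_eq_iff mean_def complex_eq_iff sum.distrib
        sum_distrib_left[symmetric] add_divide_distrib algebra_simps)
  show "\<forall>h. norm (cone_diff q h) = norm h"
  proof
    fix h
    have "(\<Sum>j\<in>UNIV. (cmod (cone_diff q h $ j))\<^sup>2) =
        (\<Sum>j\<in>UNIV. (h $ j)\<^sup>2 + 2 * (mean h)\<^sup>2 - 2 * mean h * h $ j)"
      by (simp add: cone_diff_def norm_mult assms cmod_power2 power_mult_distrib power2_diff algebra_simps)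
    also have "\<dots> = (\<Sum>j\<in>UNIV. (h $ j)\<^sup>2)"
      by (simp add: sum.distrib sum_subtractf sum_distrib_left[symmetric] sum_eq_mean power2_eq_square)
    finally show "norm (cone_diff q h) = norm h"
      by (simp add: norm_vec_def L2_set_def)
  qed
qed

text \<open>The cone is Lagrangian: rotating each coordinate by \<open>q $ j\<close> preserves the
  symplectic form, and what remains is a combination of sums of deviations from the mean.\<close>

lemma symp_form_cone_diff:
  fixes q :: "complex ^ 'n"
  assumes q: "\<And>j. cmod (q $ j) = 1"
  shows "symp_form (\<lambda>i. cone_diff q (u i)) = 0"
proof -
  have *: "Re (z * a) * Im (z * b) - Re (z * b) * Im (z * a) = (cmod z)\<^sup>2 * (Re a * Im b - Re b * Im a)"
    for z a b :: complex
    unfolding cmod_power2 by (simp add: algebra_simps power2_eq_square)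
  have "symp_form (\<lambda>i. cone_diff q (u i)) =
      (\<Sum>j\<in>UNIV. mean (u 0) * (u 1 $ j - mean (u 1)) - mean (u 1) * (u 0 $ j - mean (u 0)))"
    unfolding symp_form_eq cone_diff_def vec_lambda_beta * by (simp add: q)
  also have "\<dots> = 0"
    by (simp add: sum_subtractf sum_distrib_left[symmetric] sum_eq_mean)
  finally show ?thesis .
qed

lemma det_of_real:
  "det ((\<chi> i j. of_real (A $ i $ j)) :: 'a::{real_algebra_1, comm_ring_1} ^ 'n ^ 'n) = of_real (det A)"
  by (simp add: det_def)

text \<open>The matrix of \<open>cone_diff\<close> without phases. It is 1 on
  \<open>(1, ..., 1)\<close> and \<open>\<i>\<close> on the vectors with coordinate sum 0, so its
  determinant is \<open>\<i>^(n - 1)\<close>.\<close>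

definition cone_matrix :: "complex ^ 'n ^ 'n" where
  "cone_matrix = (\<chi> k j. (1 - \<i>) / of_nat CARD('n) + (if k = j then \<i> else 0))"

text \<open>The vectors are rows, so the linear maps act by multiplication from the right: first
  \<open>cone_matrix\<close>, then the diagonal matrix of the phases.\<close>

lemma det_cone_diff:
  fixes q :: "complex ^ 'n" and v :: "real ^ 'n ^ 'n"
  shows "det (\<chi> i. cone_diff q (v $ i)) =
    of_real (det v) * (det (cone_matrix :: complex ^ 'n ^ 'n) * (\<Prod>j\<in>UNIV. q $ j))"
proof -
  let ?V = "\<chi> i j. complex_of_real (v $ i $ j)"
  let ?Q = "(\<chi> i j. if i = j then q $ j else 0) :: complex ^ 'n ^ 'n"
  have "(\<Sum>k\<in>UNIV. complex_of_real (h $ k) * cone_matrix $ k $ j) =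
      Complex (mean h) (h $ j - mean h)" for h :: "real ^ 'n" and j
  proof -
    have "(\<Sum>k\<in>UNIV. complex_of_real (h $ k) * cone_matrix $ k $ j) =
        (\<Sum>k\<in>UNIV. complex_of_real (h $ k)) * ((1 - \<i>) / of_nat CARD('n)) + of_real (h $ j) * \<i>"
      by (simp add: cone_matrix_def distrib_left sum.distrib sum_distrib_right sum_divide_distrib mult_delta_right)
    also have "\<dots> = of_real (mean h) * (1 - \<i>) + of_real (h $ j) * \<i>"
      by (simp add: mean_def)
    finally show ?thesis by (simp add: Complex_eq algebra_simps)
  qed
  then have "(\<chi> i. cone_diff q (v $ i)) = ?V ** cone_matrix ** ?Q"
    by (simp add: vec_eq_iff cone_diff_def matrix_matrix_mult_def if_distrib
        mult.commute[of "q $ j" for j] cong: if_cong)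
  moreover have "det ?Q = (\<Prod>j\<in>UNIV. q $ j)"
    by (subst det_diagonal) auto
  ultimately show ?thesis
    by (simp add: det_mul det_of_real)
qed

lemma det_cone_matrix_3: "det (cone_matrix :: complex ^ 3 ^ 3) = - 1"
  by (simp add: det_3 cone_matrix_def complex_eq_iff)

lemma det_cone_matrix_4: "det (cone_matrix :: complex ^ 4 ^ 4) = - \<i>"
  by (simp add: det_4 cone_matrix_def complex_eq_iff)

section \<open>Periods and nonconstancy\<close>

text \<open>The displacement has mean 0, so the radius is kept, while two angles change by a full
  turn in opposite directions.\<close>

lemma cone_map_axis_period:
  assumes "j \<noteq> k"
  shows "cone_map p (axis j (2 * pi) - axis k (2 * pi)) = cone_map p 0"
proof -
  have "mean (axis j (2 * pi) - axis k (2 * pi)) = 0"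
    by (simp add: mean_def axis_def sum_subtractf)
  moreover have "exp (Complex 0 (2 * pi)) = 1" "exp (Complex 0 (- (2 * pi))) = 1" "exp (Complex 0 0) = 1"
    by (simp_all add: complex_eq_iff Re_exp Im_exp)
  ultimately show ?thesis
    using assms by (auto simp: cone_map_def vec_eq_iff axis_def mean_def)
qed

lemma not_inj_cone_map:
  assumes "j \<noteq> (k :: 'n::finite)"
  shows "\<not> inj (cone_map (p :: complex ^ 'n))"
proof
  assume "inj (cone_map p)"
  then have "axis j (2 * pi) - axis k (2 * pi) = 0"
    using cone_map_axis_period[OF assms] by (rule injD)
  then have "(axis j (2 * pi) - axis k (2 * pi)) $ j = (0 :: real ^ 'n) $ j"
    by simp
  then show False
    using assms by (simp add: axis_def)
qed

text \<open>The vector \<open>1\<close> has all entries 1, so the step from \<open>0\<close> to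
  \<open>1\<close> is radial and multiplies by \<open>exp 1\<close>.\<close>

lemma cone_map_nonconstant:
  assumes "p $ j \<noteq> 0"
  shows "cone_map p 0 \<noteq> cone_map p 1"
proof
  assume "cone_map p 0 = cone_map p 1"
  then have "cone_map p 0 $ j = cone_map p 1 $ j"
    by simp
  then have "exp (Complex 0 0) = exp (Complex 1 0)"
    using assms by (simp add: cone_map_def mean_def)
  then show False
    by (simp add: exp_eq_1 complex_eq_iff Re_exp Im_exp)
qed

section \<open>The two counterexamples\<close>

text \<open>The real component is 0, so \<open>dt\<close> kills every term of the first summand and
  only the special Lagrangian part is left.\<close>

lemma omega_assoc_cone_diff:
  fixes v :: "real ^ 3 ^ 3"
  assumes "(\<Prod>j\<in>UNIV. q $ j) = - 1"
  shows "omega_assoc (\<chi> i. (0, cone_diff q (v $ i))) = det v"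
proof -
  have "SL_form3 (\<lambda>i. (\<chi> i. cone_diff q (v $ i)) $ of_nat (Suc i)) = det v"
    unfolding SL_form3_eq_det det_cone_diff by (simp add: det_cone_matrix_3 assms)
  then show ?thesis
    by (simp add: omega_assoc_def covector_of_def pullback_def wedge_def dt_def)
qed

text \<open>Each term of the wedge square evaluates \<open>symp_form\<close> on permuted arguments;
  as \<open>symp_form_cone_diff\<close> holds for every sequence \<open>u\<close>, all of them
  vanish.\<close>

lemma omega_Cayley_cone_diff:
  fixes v :: "real ^ 4 ^ 4"
  assumes "(\<Prod>j\<in>UNIV. q $ j) = \<i>" "\<And>j. cmod (q $ j) = 1"
  shows "omega_Cayley (\<chi> i. cone_diff q (v $ i)) = det v"
proof -
  have "SL_form4 (\<lambda>i. (\<chi> i. cone_diff q (v $ i)) $ of_nat (Suc i)) = det v"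
    unfolding SL_form4_eq_det det_cone_diff by (simp add: det_cone_matrix_4 assms)
  then show ?thesis
    by (simp add: omega_Cayley_def covector_of_def wedge_def symp_form_cone_diff[OF assms(2)])
qed

lemma not_inner_moebius_rigid_assoc: "\<not> inner_moebius_rigid omega_assoc"
proof -
  \<comment> \<open>The product of the phases is the inverse of
    \<open>det cone_matrix = - 1\<close>.\<close>
  define p :: "complex ^ 3" where "p = (\<chi> j. if j = 1 then - 1 else 1)"
  have p: "cmod (p $ j) = 1" "(\<Prod>j\<in>UNIV. p $ j) = - 1" for j
    by (simp_all add: p_def)
  show ?thesis
  proof (rule not_inner_moebius_rigidI)
    show "((\<lambda>y. (0 :: real, cone_map p y)) has_derivative
        (\<lambda>h. (0, cone_diff (cone_map p y) h))) (at y)" for y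
      by (intro has_derivative_Pair has_derivative_const has_derivative_cone_map)
    show "continuous_on UNIV (\<lambda>y. (0 :: real, cone_diff (cone_map p y) h))" for h
      by (intro continuous_intros continuous_on_cone_diff_cone_map)
    show "(\<lambda>h. (0, cone_diff (cone_map p y) h)) \<in> CO_set omega_assoc" for y
    proof -
      obtain q where q: "\<And>j. cmod (q $ j) = 1" "(\<Prod>j\<in>UNIV. q $ j) = - 1"
          "cone_map p y = exp (mean y) *\<^sub>R q"
        using cone_map_eq_scaleR[of p y] p by auto
      have "linear_isometry (\<lambda>h. (0 :: real, cone_diff q h))"
        using linear_isometry_cone_diff[OF q(1)]
        by (auto simp: linear_isometry_def norm_Pair linear_iff)
      then have "(\<lambda>h. (0, cone_diff q h)) \<in> SO_set omega_assoc"
        by (simp add: SO_set_def omega_assoc_cone_diff[OF q(2)])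
      then show ?thesis
        unfolding CO_set_def q(3) cone_diff_scaleR
        by (auto intro!: exI[of _ "exp (mean y)"] exI[of _ "\<lambda>h. (0, cone_diff q h)"])
    qed
    show "(0 :: real, cone_map p 0) \<noteq> (0, cone_map p 1)"
      using cone_map_nonconstant[of p 1] by (simp add: p_def)
    show "\<not> inj (\<lambda>y. (0 :: real, cone_map p y))"
      using not_inj_cone_map[of 1 2 p] by (auto simp: inj_def)
  qed
qed

lemma not_inner_moebius_rigid_Cayley: "\<not> inner_moebius_rigid omega_Cayley"
proof -
  \<comment> \<open>Here \<open>det cone_matrix = - \<i>\<close>, whose inverse is
    \<open>\<i>\<close>.\<close>
  define p :: "complex ^ 4" where "p = (\<chi> j. if j = 1 then \<i> else 1)"
  have p: "cmod (p $ j) = 1" "(\<Prod>j\<in>UNIV. p $ j) = \<i>" for j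
    by (simp_all add: p_def)
  show ?thesis
  proof (rule not_inner_moebius_rigidI[OF has_derivative_cone_map continuous_on_cone_diff_cone_map])
    show "cone_diff (cone_map p y) \<in> CO_set omega_Cayley" for y
    proof -
      obtain q where q: "\<And>j. cmod (q $ j) = 1" "(\<Prod>j\<in>UNIV. q $ j) = \<i>"
          "cone_map p y = exp (mean y) *\<^sub>R q"
        using cone_map_eq_scaleR[of p y] p by auto
      have "cone_diff q \<in> SO_set omega_Cayley"
        by (simp add: SO_set_def linear_isometry_cone_diff q omega_Cayley_cone_diff)
      then show ?thesis
        unfolding CO_set_def q(3) cone_diff_scaleR[abs_def] by (auto intro!: exI[of _ "exp (mean y)"])
    qed
    show "cone_map p 0 \<noteq> cone_map p 1"
      by (rule cone_map_nonconstant[of p 1]) (simp add: p_def)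
    show "\<not> inj (cone_map p)"
      using not_inj_cone_map[of 1 2 p] by simp
  qed
qed

theorem corollary6p3:
  "\<not> inner_moebius_rigid omega_assoc \<and> \<not> inner_moebius_rigid omega_Cayley"
  using not_inner_moebius_rigid_assoc not_inner_moebius_rigid_Cayley by simp

end
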